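(* Let $S$ be an infinite set, let $(R_k)_{k\in S}$ be a family of nonzero commutative rings each of which has only finitely many idempotents, and let $R=\prod_{k\in S}R_k$. Then the set of wild max-regular ideals of $R$ has cardinality $2^{2^{|S|}}$.
   Context: All rings are commutative with identity. A regular ideal of a ring $A$ is an ideal generated by a set of idempotents of $A$. A max-regular ideal of $A$ is a maximal element (with respect to inclusion) of the set of proper regular ideals of $A$. With $\pi_k:R\to R_k$ the projection map, a tame prime of $R=\prod_{k\in S}R_k$ is a prime ideal of $R$ of the form $\pi_k^{-1}(\mathfrak p)$ for some $k\in S$ and some prime ideal $\mathfrak p$ of $R_k$; a wild prime of $R$ is a prime ideal of $R$ which is not tame. A wild max-regular ideal of $R$ is a max-regular ideal $M$ of $R$ such that $V(M)=\{\mathfrak p\in\operatorname{Spec}(R): M\subseteq\mathfrak p\}$ is contained in the set of wild primes of $R$. *)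

theory Defs
  imports "HOL-Algebra.Ideal" "HOL-Library.Equipollence"
begin

text \<open>The elements of the product of a family of rings are the extensional functions in the
  dependent product of the carriers, as in \<open>product_group\<close> of \<open>HOL-Algebra.Product_Groups\<close>.\<close>

definition product_ring :: "'i set \<Rightarrow> ('i \<Rightarrow> ('a, 'm) ring_scheme) \<Rightarrow> ('i \<Rightarrow> 'a) ring" where
  "product_ring S R =
     \<lparr>carrier = (\<Pi>\<^sub>E k\<in>S. carrier (R k)),
      monoid.mult = (\<lambda>x y. \<lambda>k\<in>S. x k \<otimes>\<^bsub>R k\<^esub> y k),
      one = (\<lambda>k\<in>S. \<one>\<^bsub>R k\<^esub>),
      zero = (\<lambda>k\<in>S. \<zero>\<^bsub>R k\<^esub>),
      add = (\<lambda>x y. \<lambda>k\<in>S. x k \<oplus>\<^bsub>R k\<^esub> y k)\<rparr>"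

lemma cring_product_ring:
  assumes "\<And>k. k \<in> S \<Longrightarrow> cring (R k)"
  shows "cring (product_ring S R)"
proof -
  have r: "ring (R k)" "abelian_group (R k)" "monoid (R k)" "comm_monoid (R k)" if "k \<in> S" for k
    using assms[OF that] by (simp_all add: cring_def ring_def comm_monoid_def)
  show ?thesis
  proof (intro cringI abelian_groupI comm_monoidI)
    fix x assume x: "x \<in> carrier (product_ring S R)"
    let ?y = "\<lambda>k\<in>S. \<ominus>\<^bsub>R k\<^esub> x k"
    have "?y \<in> carrier (product_ring S R)"
      using x r by (auto simp: product_ring_def PiE_iff abelian_group.a_inv_closed)
    moreover have "?y \<oplus>\<^bsub>product_ring S R\<^esub> x = \<zero>\<^bsub>product_ring S R\<^esub>"
      using x r by (auto simp: product_ring_def PiE_iff abelian_group.l_neg fun_eq_iff)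
    ultimately show "\<exists>y\<in>carrier (product_ring S R).
        y \<oplus>\<^bsub>product_ring S R\<^esub> x = \<zero>\<^bsub>product_ring S R\<^esub>"
      by blast
  qed (use r in \<open>auto simp: product_ring_def PiE_iff fun_eq_iff extensional_def
        abelian_groupE monoid.m_closed monoid.m_assoc monoid.l_one comm_monoid.m_comm comm_monoid.m_lcomm
        abelian_groupE ring.ring_simprules cring.cring_simprules\<close>)
qed

definition ring_proj ::
  "'i set \<Rightarrow> ('i \<Rightarrow> ('a, 'm) ring_scheme) \<Rightarrow> 'i \<Rightarrow> ('i \<Rightarrow> 'a) \<Rightarrow> 'a" where
  "ring_proj S R k = (\<lambda>x\<in>carrier (product_ring S R). x k)"

definition idempotents :: "('a, 'm) ring_scheme \<Rightarrow> 'a set" where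
  "idempotents A = {e \<in> carrier A. e \<otimes>\<^bsub>A\<^esub> e = e}"

definition regular_ideal :: "('a, 'm) ring_scheme \<Rightarrow> 'a set \<Rightarrow> bool" where
  "regular_ideal A I \<longleftrightarrow> (\<exists>E \<subseteq> idempotents A. I = Idl\<^bsub>A\<^esub> E)"

definition max_regular_ideal :: "('a, 'm) ring_scheme \<Rightarrow> 'a set \<Rightarrow> bool" where
  "max_regular_ideal A M \<longleftrightarrow>
     regular_ideal A M \<and> M \<noteq> carrier A \<and>
     (\<forall>J. regular_ideal A J \<and> J \<noteq> carrier A \<and> M \<subseteq> J \<longrightarrow> J = M)"

definition Spec :: "('a, 'm) ring_scheme \<Rightarrow> 'a set set" where
  "Spec A = {P. primeideal P A}"

definition zero_locus :: "('a, 'm) ring_scheme \<Rightarrow> 'a set \<Rightarrow> 'a set set" where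
  "zero_locus A I = {P \<in> Spec A. I \<subseteq> P}"

definition tame_primes :: "'i set \<Rightarrow> ('i \<Rightarrow> ('a, 'm) ring_scheme) \<Rightarrow> ('i \<Rightarrow> 'a) set set" where
  "tame_primes S R =
     {P \<in> Spec (product_ring S R).
        \<exists>k\<in>S. \<exists>p\<in>Spec (R k). P = ring_proj S R k -` p \<inter> carrier (product_ring S R)}"

definition wild_primes :: "'i set \<Rightarrow> ('i \<Rightarrow> ('a, 'm) ring_scheme) \<Rightarrow> ('i \<Rightarrow> 'a) set set" where
  "wild_primes S R = Spec (product_ring S R) - tame_primes S R"

definition wild_max_regular_ideals ::
  "'i set \<Rightarrow> ('i \<Rightarrow> ('a, 'm) ring_scheme) \<Rightarrow> ('i \<Rightarrow> 'a) set set" where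
  "wild_max_regular_ideals S R =
     {M. max_regular_ideal (product_ring S R) M \<and>
         zero_locus (product_ring S R) M \<subseteq> wild_primes S R}"

end

theory Submission
  imports Defs "HOL-Algebra.Ring_Divisibility"
begin

text \<open>A regular ideal is determined by the idempotents it contains, and the product ring has at
  most \<open>2\<^sup>|\<^sup>S\<^sup>|\<close> idempotents; this gives the upper bound. For the lower bound take an independent
  family \<open>A\<^sub>T\<close> of \<open>2\<^sup>|\<^sup>S\<^sup>|\<close> subsets of \<open>S\<close> (Fichtenholz, Kantorovich, Hausdorff). A set \<open>C\<close> of
  indices \<open>T\<close> yields the ideal generated by the indicator idempotents of the \<open>A\<^sub>T\<close> with \<open>T \<in> C\<close>, of
  the complements of the \<open>A\<^sub>T\<close> with \<open>T \<notin> C\<close>, and of the singletons. Independence makes it proper, so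
  by Zorn it lies in a max-regular ideal; two different choices of \<open>C\<close> put complementary
  idempotents into the two ideals, so these differ. The indicator of \<open>{k}\<close> projects to \<open>1\<close> in
  \<open>R\<^sub>k\<close>, so no tame prime contains such an ideal.\<close>

section \<open>Independent families of sets\<close>

lemma lepoll_iff_card_of_ordLeq: "A \<lesssim> B \<longleftrightarrow> ordLeq3 (card_of A) (card_of B)"
  by (simp add: lepoll_def card_of_ordLeq)

lemma infinite_times_lepoll:
  assumes "infinite S" "A \<lesssim> S" "B \<lesssim> S"
  shows "A \<times> B \<lesssim> S"
  using lepoll_trans2[OF times_lepoll_mono[OF assms(2,3)]] card_of_Times_same_infinite[OF assms(1)]
  by (simp add: eqpoll_iff_card_of_ordIso)

lemma Pow_lepoll_mono:
  assumes "A \<lesssim> B"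
  shows "Pow A \<lesssim> Pow B"
proof -
  obtain f where f: "inj_on f A" "f ` A \<subseteq> B"
    using assms by (auto simp: lepoll_def)
  show ?thesis
    unfolding lepoll_def using f inj_on_image_Pow by (intro exI[of _ "image f"]) blast
qed

text \<open>Inserting a point into an n-element subset yields every subset of size n + 1, so by
  induction there are at most |S| subsets of each finite size. A countable union of families of size
  at most |S| is no larger, since \<open>S\<close> is infinite.\<close>

lemma Fpow_lepoll_infinite:
  assumes "infinite S"
  shows "Fpow S \<lesssim> S"
proof -
  define N where "N n = {F. F \<subseteq> S \<and> finite F \<and> card F = n}" for n
  have N: "N n \<lesssim> S" for n
  proof (induction n)
    case 0
    have "N 0 = {{}}"
      by (auto simp: N_def)
    then show ?case
      using assms by (simp add: finite_lepoll_infinite)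
  next
    case (Suc n)
    have "N (Suc n) \<subseteq> (\<lambda>(x, F). insert x F) ` (S \<times> N n)"
    proof
      fix F assume "F \<in> N (Suc n)"
      then obtain x G where "F = insert x G" "x \<notin> G" "card G = n" "F \<subseteq> S" "finite F"
        by (auto simp: N_def card_Suc_eq)
      then show "F \<in> (\<lambda>(x, F). insert x F) ` (S \<times> N n)"
        by (auto simp: N_def)
    qed
    then have "N (Suc n) \<lesssim> S \<times> N n"
      by (rule subset_image_lepoll)
    also have "\<dots> \<lesssim> S"
      using assms Suc by (intro infinite_times_lepoll) auto
    finally show ?case .
  qed
  have "ordLeq3 (card_of (UNIV :: nat set)) (card_of S)"
    using assms infinite_le_lepoll lepoll_iff_card_of_ordLeq by blast
  then have "(\<Union>n. N n) \<lesssim> S"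
    using N assms by (simp add: lepoll_iff_card_of_ordLeq card_of_UNION_ordLeq_infinite)
  moreover have "Fpow S = (\<Union>n. N n)"
    by (auto simp: N_def Fpow_def)
  ultimately show ?thesis
    by simp
qed

text \<open>One point from the symmetric difference of each pair of distinct members is enough to
  tell all members apart.\<close>

lemma finite_separating_set:
  assumes "finite U" "\<And>T. T \<in> U \<Longrightarrow> T \<subseteq> S"
  obtains F where "finite F" "F \<subseteq> S" "inj_on (\<lambda>T. F \<inter> T) U"
proof -
  define d :: "'a set \<times> 'a set \<Rightarrow> 'a" where "d = (\<lambda>(T, T'). SOME x. x \<in> (T - T') \<union> (T' - T))"
  define F where "F = d ` {(T, T'). T \<in> U \<and> T' \<in> U \<and> T \<noteq> T'}"
  have d: "d (T, T') \<in> (T - T') \<union> (T' - T)" if "T \<noteq> T'" for T T'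
    unfolding d_def prod.case by (rule someI_ex) (use that in blast)
  have "finite {(T, T'). T \<in> U \<and> T' \<in> U \<and> T \<noteq> T'}"
    by (rule finite_subset[of _ "U \<times> U"]) (use assms in auto)
  then have "finite F"
    by (simp add: F_def)
  moreover have "F \<subseteq> S"
  proof
    fix x assume "x \<in> F"
    then obtain T T' where *: "T \<in> U" "T' \<in> U" "T \<noteq> T'" "x = d (T, T')"
      by (auto simp: F_def)
    then show "x \<in> S"
      using d[OF *(3)] assms(2)[OF *(1)] assms(2)[OF *(2)] by blast
  qed
  moreover have "inj_on (\<lambda>T. F \<inter> T) U"
  proof (rule inj_onI, rule ccontr)
    fix T T' assume *: "T \<in> U" "T' \<in> U" "F \<inter> T = F \<inter> T'" "T \<noteq> T'"
    then have "d (T, T') \<in> F"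
      by (auto simp: F_def)
    then show False
      using d[OF \<open>T \<noteq> T'\<close>] * by blast
  qed
  ultimately show ?thesis
    using that by blast
qed

text \<open>Hausdorff's construction: up to an injection into \<open>S\<close>, the points are pairs \<open>(F, G)\<close> of a finite
  set \<open>F \<subseteq> S\<close> and a finite set \<open>G\<close> of possible traces on \<open>F\<close>, and \<open>A\<^sub>T\<close> asks that the trace of
  \<open>T\<close> on \<open>F\<close> belong to \<open>G\<close>.\<close>

lemma independent_family:
  assumes "infinite S"
  obtains A :: "'a set \<Rightarrow> 'a set" where
    "\<And>P Q. \<lbrakk>finite P; finite Q; P \<subseteq> Pow S; Q \<subseteq> Pow S; P \<inter> Q = {}\<rbrakk> \<Longrightarrow>
      infinite {s \<in> S. (\<forall>T\<in>P. s \<in> A T) \<and> (\<forall>T\<in>Q. s \<notin> A T)}"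
proof -
  define X where "X = Fpow S \<times> Fpow (Fpow S)"
  \<comment> \<open>This allows \<open>Fpow_lepoll_infinite\<close> to be applied to
    \<open>Fpow S\<close> itself, which bounds the second component of \<open>X\<close>.\<close>
  have "infinite (Fpow S)"
  proof
    assume "finite (Fpow S)"
    then have "finite ((\<lambda>x. {x}) -` Fpow S)"
      by (rule finite_vimageI) simp
    moreover have "S \<subseteq> (\<lambda>x. {x}) -` Fpow S"
      by (auto simp: Fpow_def)
    ultimately show False
      using assms finite_subset by blast
  qed
  then have "Fpow (Fpow S) \<lesssim> S"
    using Fpow_lepoll_infinite Fpow_lepoll_infinite[OF assms] lepoll_trans by metis
  then have "X \<lesssim> S"
    unfolding X_def using assms by (intro infinite_times_lepoll Fpow_lepoll_infinite)
  then obtain g where g: "inj_on g X" "g ` X \<subseteq> S"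
    by (auto simp: lepoll_def)
  define A where "A T = g ` {(F, G) \<in> X. F \<inter> T \<in> G}" for T
  have A: "g (F, G) \<in> A T \<longleftrightarrow> F \<inter> T \<in> G" if "(F, G) \<in> X" for F G T
    using that g(1) by (auto simp: A_def dest: inj_onD)
  show ?thesis
  proof (rule that[of A])
    fix P Q assume PQ: "finite P" "finite Q" "P \<subseteq> Pow S" "Q \<subseteq> Pow S" "P \<inter> Q = {}"
    then obtain F where F: "finite F" "F \<subseteq> S" "inj_on (\<lambda>T. F \<inter> T) (P \<union> Q)"
      using finite_separating_set[of "P \<union> Q" S] by (metis PowD UnE finite_UnI subsetD)
    \<comment> \<open>Enlarging \<open>F\<close> by \<open>y\<close> keeps the traces of
      \<open>P \<union> Q\<close> distinct, and different \<open>y\<close> outside \<open>F\<close>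
      give different points, so there are infinitely many witnesses. With the traces of the members
      of \<open>P\<close> as second component, the point lies in \<open>A T\<close> for
      \<open>T\<close> in \<open>P\<close> and outside \<open>A T\<close> for \<open>T\<close> in
      \<open>Q\<close>.\<close>
    define h where "h y = (insert y F, (\<lambda>T. insert y F \<inter> T) ` P)" for y
    have hX: "h y \<in> X" if "y \<in> S" for y
      using that F PQ by (auto simp: h_def X_def Fpow_def)
    have "inj_on h (S - F)"
      by (auto simp: inj_on_def h_def)
    then have "inj_on (g \<circ> h) (S - F)"
      by (rule comp_inj_on) (rule inj_on_subset[OF g(1)], use hX in auto)
    moreover have "infinite (S - F)"
      using assms F by simp
    ultimately have "infinite ((g \<circ> h) ` (S - F))"
      using finite_image_iff by blast
    moreover have "(g \<circ> h) ` (S - F) \<subseteq> {s \<in> S. (\<forall>T\<in>P. s \<in> A T) \<and> (\<forall>T\<in>Q. s \<notin> A T)}"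
    proof clarsimp
      fix y assume y: "y \<in> S" "y \<notin> F"
      have "g (h y) \<in> S"
        using hX g y by blast
      moreover have "g (h y) \<in> A T" if "T \<in> P" for T
        using A hX[OF y(1)] that by (simp add: h_def)
      moreover have "g (h y) \<notin> A T" if "T \<in> Q" for T
      proof
        assume "g (h y) \<in> A T"
        then obtain T' where "T' \<in> P" "insert y F \<inter> T = insert y F \<inter> T'"
          using A hX[OF y(1)] by (auto simp: h_def)
        \<comment> \<open>Intersecting with \<open>F\<close> leads back to the traces that separate
          \<open>P\<close> from \<open>Q\<close>.\<close>
        then have "T' \<in> P" "F \<inter> T = F \<inter> T'"
          by auto
        then show False
          using inj_onD[OF F(3), of T T'] that PQ(5) by blast
      qed
      ultimately show "g (h y) \<in> S \<and> (\<forall>T\<in>P. g (h y) \<in> A T) \<and> (\<forall>T\<in>Q. g (h y) \<notin> A T)"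
        by blast
    qed
    ultimately show "infinite {s \<in> S. (\<forall>T\<in>P. s \<in> A T) \<and> (\<forall>T\<in>Q. s \<notin> A T)}"
      using finite_subset by blast
  qed
qed

section \<open>Regular ideals\<close>

lemma (in ring) Int_idempotents_carrier: "I \<inter> idempotents R \<subseteq> carrier R"
  by (auto simp: idempotents_def)

text \<open>Adding to the generators every idempotent of the ideal does not enlarge it. This
  replaces an unspecified generating set by a canonical one, so that a regular ideal can be
  recovered from its idempotents and regularity can be checked for unions of chains.\<close>

lemma (in ring) regular_ideal_iff:
  "regular_ideal R I \<longleftrightarrow> ideal I R \<and> I = Idl (I \<inter> idempotents R)"
proof
  assume "regular_ideal R I"
  then obtain E where E: "E \<subseteq> idempotents R" "I = Idl E"
    by (auto simp: regular_ideal_def)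
  moreover from E have "E \<subseteq> carrier R"
    by (auto simp: idempotents_def)
  ultimately have I: "ideal I R" "E \<subseteq> I"
    using genideal_ideal genideal_self by simp_all
  have "I \<subseteq> Idl (I \<inter> idempotents R)"
    unfolding E(2)
  proof (rule genideal_minimal)
    show "ideal (Idl (Idl E \<inter> idempotents R)) R"
      by (intro genideal_ideal Int_idempotents_carrier)
    show "E \<subseteq> Idl (Idl E \<inter> idempotents R)"
      using E I genideal_self[OF Int_idempotents_carrier, of "Idl E"] by blast
  qed
  moreover have "Idl (I \<inter> idempotents R) \<subseteq> I"
    using I by (intro genideal_minimal) auto
  ultimately show "ideal I R \<and> I = Idl (I \<inter> idempotents R)"
    using I by blast
next
  assume "ideal I R \<and> I = Idl (I \<inter> idempotents R)"
  then show "regular_ideal R I"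
    unfolding regular_ideal_def by blast
qed

lemma (in ring) regular_ideals_lepoll: "{I. regular_ideal R I} \<lesssim> Pow (idempotents R)"
proof -
  have "inj_on (\<lambda>I. I \<inter> idempotents R) {I. regular_ideal R I}"
    by (rule inj_on_inverseI[where g = "genideal R"]) (use regular_ideal_iff in auto)
  then show ?thesis
    unfolding lepoll_def by blast
qed

text \<open>Zorn's lemma applies to the proper regular ideals above \<open>I\<close>: the union of a
  nonempty chain is generated by its idempotents because each member is, and it is proper because no
  member contains 1. A maximal element here is max-regular, since every ideal above it also contains
  \<open>I\<close>.\<close>

lemma (in ring) regular_ideal_le_max_regular:
  assumes "regular_ideal R I" "I \<noteq> carrier R"
  obtains M where "max_regular_ideal R M" "I \<subseteq> M"
proof -
  define \<A> where "\<A> = {J. regular_ideal R J \<and> J \<noteq> carrier R \<and> I \<subseteq> J}"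
  have "\<exists>M\<in>\<A>. \<forall>J\<in>\<A>. M \<subseteq> J \<longrightarrow> J = M"
  proof (rule subset_Zorn_nonempty)
    show "\<A> \<noteq> {}"
      using assms by (auto simp: \<A>_def)
    fix C assume C: "C \<noteq> {}" "subset.chain \<A> C"
    then have CA: "C \<subseteq> \<A>"
      by (simp add: pred_on.chain_def)
    have ch: "subset.chain {I. ideal I R} C"
      using C(2) regular_ideal_iff by (auto simp: pred_on.chain_def \<A>_def)
    then have U: "ideal (\<Union>C) R"
      using chain_Union_is_ideal[OF ch] C(1) by simp
    have sub: "Idl (\<Union>C \<inter> idempotents R) \<subseteq> \<Union>C"
      using U by (intro genideal_minimal) auto
    have "J \<subseteq> Idl (\<Union>C \<inter> idempotents R)" if "J \<in> C" for J
    proof -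
      have "J = Idl (J \<inter> idempotents R)"
        using that CA regular_ideal_iff by (auto simp: \<A>_def)
      moreover have "Idl (J \<inter> idempotents R) \<subseteq> Idl (\<Union>C \<inter> idempotents R)"
      proof (rule genideal_minimal)
        show "ideal (Idl (\<Union>C \<inter> idempotents R)) R"
          by (intro genideal_ideal Int_idempotents_carrier)
        show "J \<inter> idempotents R \<subseteq> Idl (\<Union>C \<inter> idempotents R)"
          using that genideal_self[OF Int_idempotents_carrier, of "\<Union>C"] by blast
      qed
      ultimately show ?thesis
        by blast
    qed
    with sub have "\<Union>C = Idl (\<Union>C \<inter> idempotents R)"
      by blast
    then have "regular_ideal R (\<Union>C)"
      using U regular_ideal_iff by blast
    moreover have "\<one> \<notin> J" if "J \<in> C" for J
    proof -
      have "ideal J R" "J \<noteq> carrier R"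
        using that CA regular_ideal_iff by (auto simp: \<A>_def)
      then show ?thesis
        using ideal.one_imp_carrier by blast
    qed
    then have "\<Union>C \<noteq> carrier R"
      by blast
    moreover have "I \<subseteq> \<Union>C"
      using C(1) CA by (auto simp: \<A>_def)
    ultimately show "\<Union>C \<in> \<A>"
      by (simp add: \<A>_def)
  qed
  then obtain M where "M \<in> \<A>" "\<And>J. J \<in> \<A> \<Longrightarrow> M \<subseteq> J \<Longrightarrow> J = M"
    by blast
  then show ?thesis
    by (intro that[of M]) (auto simp: \<A>_def max_regular_ideal_def)
qed

section \<open>Idempotents of a product\<close>

definition indicator_elt :: "'i set \<Rightarrow> ('i \<Rightarrow> ('a, 'm) ring_scheme) \<Rightarrow> 'i set \<Rightarrow> 'i \<Rightarrow> 'a" where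
  "indicator_elt S R A = (\<lambda>k\<in>S. if k \<in> A then \<one>\<^bsub>R k\<^esub> else \<zero>\<^bsub>R k\<^esub>)"

lemma product_ring_simps:
  "carrier (product_ring S R) = (\<Pi>\<^sub>E k\<in>S. carrier (R k))"
  "x \<otimes>\<^bsub>product_ring S R\<^esub> y = (\<lambda>k\<in>S. x k \<otimes>\<^bsub>R k\<^esub> y k)"
  "\<one>\<^bsub>product_ring S R\<^esub> = (\<lambda>k\<in>S. \<one>\<^bsub>R k\<^esub>)"
  "\<zero>\<^bsub>product_ring S R\<^esub> = (\<lambda>k\<in>S. \<zero>\<^bsub>R k\<^esub>)"
  "x \<oplus>\<^bsub>product_ring S R\<^esub> y = (\<lambda>k\<in>S. x k \<oplus>\<^bsub>R k\<^esub> y k)"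
  by (simp_all add: product_ring_def)

locale cring_family =
  fixes S :: "'i set" and R :: "'i \<Rightarrow> ('a, 'm) ring_scheme"
  assumes cring_factor: "k \<in> S \<Longrightarrow> cring (R k)"

sublocale cring_family \<subseteq> prod: cring "product_ring S R"
  using cring_factor by (rule cring_product_ring)

context cring_family
begin

lemma ring_factor: "k \<in> S \<Longrightarrow> ring (R k)"
  using cring_factor by (simp add: cring_def)

section \<open>Indicator idempotents and the ideals they generate\<close>

lemma indicator_elt_idempotent: "indicator_elt S R A \<in> idempotents (product_ring S R)"
proof -
  have "indicator_elt S R A k \<in> carrier (R k)"
    "indicator_elt S R A k \<otimes>\<^bsub>R k\<^esub> indicator_elt S R A k = indicator_elt S R A k" if "k \<in> S" for k
  proof -
    interpret ring "R k"
      using that by (rule ring_factor)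
    show "indicator_elt S R A k \<in> carrier (R k)"
      "indicator_elt S R A k \<otimes>\<^bsub>R k\<^esub> indicator_elt S R A k = indicator_elt S R A k"
      using that by (simp_all add: indicator_elt_def)
  qed
  then show ?thesis
    by (auto simp: idempotents_def product_ring_simps PiE_iff indicator_elt_def fun_eq_iff)
qed

lemma indicator_elt_compl:
  "indicator_elt S R A \<oplus>\<^bsub>product_ring S R\<^esub> indicator_elt S R (S - A) = \<one>\<^bsub>product_ring S R\<^esub>"
proof -
  have "\<one>\<^bsub>R k\<^esub> \<oplus>\<^bsub>R k\<^esub> \<zero>\<^bsub>R k\<^esub> = \<one>\<^bsub>R k\<^esub>" "\<zero>\<^bsub>R k\<^esub> \<oplus>\<^bsub>R k\<^esub> \<one>\<^bsub>R k\<^esub> = \<one>\<^bsub>R k\<^esub>" if "k \<in> S" for k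
  proof -
    interpret ring "R k"
      using that by (rule ring_factor)
    show "\<one>\<^bsub>R k\<^esub> \<oplus>\<^bsub>R k\<^esub> \<zero>\<^bsub>R k\<^esub> = \<one>\<^bsub>R k\<^esub>" "\<zero>\<^bsub>R k\<^esub> \<oplus>\<^bsub>R k\<^esub> \<one>\<^bsub>R k\<^esub> = \<one>\<^bsub>R k\<^esub>"
      by simp_all
  qed
  then show ?thesis
    by (auto simp: product_ring_simps indicator_elt_def fun_eq_iff)
qed

text \<open>This ideal, of elements whose support is covered by finitely many members of
  \<open>\<F>\<close>, serves as an explicit upper bound for the ideal generated by the indicators
  of the members of \<open>\<F>\<close>.\<close>

lemma support_ideal:
  "ideal {x \<in> carrier (product_ring S R).
     \<exists>F. finite F \<and> F \<subseteq> \<F> \<and> (\<forall>k\<in>S - \<Union>F. x k = \<zero>\<^bsub>R k\<^esub>)} (product_ring S R)"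
  (is "ideal ?J _")
proof (rule idealI[OF prod.ring_axioms])
  have absorb: "a \<otimes>\<^bsub>product_ring S R\<^esub> x \<in> ?J"
    if x: "x \<in> ?J" and a: "a \<in> carrier (product_ring S R)" for a x
  proof -
    obtain F where F: "finite F" "F \<subseteq> \<F>" "\<forall>k\<in>S - \<Union>F. x k = \<zero>\<^bsub>R k\<^esub>"
      using x by blast
    have "(a \<otimes>\<^bsub>product_ring S R\<^esub> x) k = \<zero>\<^bsub>R k\<^esub>" if "k \<in> S - \<Union>F" for k
    proof -
      interpret ring "R k"
        using that ring_factor by blast
      have "a k \<in> carrier (R k)"
        using a that by (auto simp: product_ring_simps)
      then show ?thesis
        using F that by (simp add: product_ring_simps)
    qed
    then show ?thesis
      using F a x prod.m_closed by blast
  qed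
  then show "\<And>a x. \<lbrakk>a \<in> ?J; x \<in> carrier (product_ring S R)\<rbrakk> \<Longrightarrow> x \<otimes>\<^bsub>product_ring S R\<^esub> a \<in> ?J"
    by blast
  show "\<And>a x. \<lbrakk>a \<in> ?J; x \<in> carrier (product_ring S R)\<rbrakk> \<Longrightarrow> a \<otimes>\<^bsub>product_ring S R\<^esub> x \<in> ?J"
    by (subst prod.m_comm) (use absorb in auto)
  show "subgroup ?J (add_monoid (product_ring S R))"
  proof (rule prod.add.subgroupI)
    show "?J \<subseteq> carrier (product_ring S R)"
      by blast
    have "\<zero>\<^bsub>product_ring S R\<^esub> \<in> ?J"
      using prod.zero_closed by (auto simp: product_ring_simps intro!: exI[of _ "{}"])
    then show "?J \<noteq> {}"
      by blast
    show "\<ominus>\<^bsub>product_ring S R\<^esub> x \<in> ?J" if "x \<in> ?J" for x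
    proof -
      \<comment> \<open>Negation is multiplication by -1, so closure under it is a case of
        absorption.\<close>
      have "\<ominus>\<^bsub>product_ring S R\<^esub> x = (\<ominus>\<^bsub>product_ring S R\<^esub> \<one>\<^bsub>product_ring S R\<^esub>) \<otimes>\<^bsub>product_ring S R\<^esub> x"
        using that by (simp add: prod.l_minus)
      then show ?thesis
        using absorb[OF that prod.a_inv_closed[OF prod.one_closed]] by simp
    qed
    show "x \<oplus>\<^bsub>product_ring S R\<^esub> y \<in> ?J" if x: "x \<in> ?J" and y: "y \<in> ?J" for x y
    proof -
      obtain F G where F: "finite F" "F \<subseteq> \<F>" "\<forall>k\<in>S - \<Union>F. x k = \<zero>\<^bsub>R k\<^esub>"
        and G: "finite G" "G \<subseteq> \<F>" "\<forall>k\<in>S - \<Union>G. y k = \<zero>\<^bsub>R k\<^esub>"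
        using x y by blast
      have "(x \<oplus>\<^bsub>product_ring S R\<^esub> y) k = \<zero>\<^bsub>R k\<^esub>" if "k \<in> S - \<Union>(F \<union> G)" for k
      proof -
        interpret ring "R k"
          using that ring_factor by blast
        show ?thesis
          using F G that by (simp add: product_ring_simps)
      qed
      then show ?thesis
        using F G x y prod.a_closed by (auto intro!: exI[of _ "F \<union> G"])
    qed
  qed
qed

text \<open>The generated ideal lies inside the ideal of \<open>support_ideal\<close>. The element 1
  has full support because every factor is nonzero, so its membership would give a finite cover of
  \<open>S\<close> by members of \<open>\<F>\<close>.\<close>

lemma genideal_indicator_elt_proper:
  assumes nontrivial: "\<And>k. k \<in> S \<Longrightarrow> carrier (R k) \<noteq> {\<zero>\<^bsub>R k\<^esub>}"
    and no_cover: "\<And>F. \<lbrakk>finite F; F \<subseteq> \<F>\<rbrakk> \<Longrightarrow> \<not> S \<subseteq> \<Union>F"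
  shows "Idl\<^bsub>product_ring S R\<^esub> (indicator_elt S R ` \<F>) \<noteq> carrier (product_ring S R)"
proof
  let ?J = "{x \<in> carrier (product_ring S R).
     \<exists>F. finite F \<and> F \<subseteq> \<F> \<and> (\<forall>k\<in>S - \<Union>F. x k = \<zero>\<^bsub>R k\<^esub>)}"
  assume eq: "Idl\<^bsub>product_ring S R\<^esub> (indicator_elt S R ` \<F>) = carrier (product_ring S R)"
  have "indicator_elt S R A \<in> ?J" if "A \<in> \<F>" for A
    using that indicator_elt_idempotent[of A]
    by (auto simp: idempotents_def indicator_elt_def intro!: exI[of _ "{A}"])
  then have "Idl\<^bsub>product_ring S R\<^esub> (indicator_elt S R ` \<F>) \<subseteq> ?J"
    by (intro prod.genideal_minimal support_ideal) blast
  then have "\<one>\<^bsub>product_ring S R\<^esub> \<in> ?J"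
    using eq prod.one_closed by blast
  then obtain F where F: "finite F" "F \<subseteq> \<F>" "\<forall>k\<in>S - \<Union>F. \<one>\<^bsub>product_ring S R\<^esub> k = \<zero>\<^bsub>R k\<^esub>"
    by blast
  obtain k where k: "k \<in> S" "k \<notin> \<Union>F"
    using no_cover[OF F(1,2)] by blast
  interpret ring "R k"
    using k(1) by (rule ring_factor)
  have "\<one>\<^bsub>R k\<^esub> = \<zero>\<^bsub>R k\<^esub>"
    using F(3) k by (simp add: product_ring_simps)
  then show False
    using nontrivial[OF k(1)] one_zeroD by blast
qed

lemma zero_locus_wild:
  assumes "\<And>k. k \<in> S \<Longrightarrow> indicator_elt S R {k} \<in> M"
  shows "zero_locus (product_ring S R) M \<subseteq> wild_primes S R"
proof -
  have False if P: "M \<subseteq> P" "P = ring_proj S R k -` p \<inter> carrier (product_ring S R)"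
    and k: "k \<in> S" "p \<in> Spec (R k)" for P k p
  proof -
    have "ring_proj S R k (indicator_elt S R {k}) \<in> p" "indicator_elt S R {k} \<in> carrier (product_ring S R)"
      using assms[OF k(1)] P by auto
    then have one: "\<one>\<^bsub>R k\<^esub> \<in> p"
      using k by (simp add: ring_proj_def indicator_elt_def)
    interpret primeideal p "R k"
      using k(2) by (simp add: Spec_def)
    show False
      using one_imp_carrier[OF one] I_notcarr by simp
  qed
  then show ?thesis
    unfolding zero_locus_def wild_primes_def tame_primes_def by blast
qed

text \<open>Numbering the finitely many idempotents of each factor turns an idempotent of the
  product into a function from \<open>S\<close> to the naturals. Its graph is a subset of a set of
  size |S|.\<close>

lemma idempotents_product_lepoll:
  assumes "infinite S" "\<And>k. k \<in> S \<Longrightarrow> finite (idempotents (R k))"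
  shows "idempotents (product_ring S R) \<lesssim> Pow S"
proof -
  define graph where "graph e = {(k, to_nat_on (idempotents (R k)) (e k)) | k. k \<in> S}"
    for e :: "'i \<Rightarrow> 'a"
  have idem: "e k \<in> idempotents (R k)" if "e \<in> idempotents (product_ring S R)" "k \<in> S" for e k
    using that by (auto simp: idempotents_def product_ring_simps dest: fun_cong[of _ _ k])
  have "inj_on graph (idempotents (product_ring S R))"
  proof (rule inj_onI)
    fix e f assume e: "e \<in> idempotents (product_ring S R)" and f: "f \<in> idempotents (product_ring S R)"
      and eq: "graph e = graph f"
    have "e k = f k" if k: "k \<in> S" for k
    proof -
      have "(k, to_nat_on (idempotents (R k)) (e k)) \<in> graph f"
        using k by (subst eq[symmetric]) (auto simp: graph_def)
      then have "to_nat_on (idempotents (R k)) (e k) = to_nat_on (idempotents (R k)) (f k)"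
        by (auto simp: graph_def)
      then show ?thesis
        using idem[OF e k] idem[OF f k] assms(2)[OF k] by (simp add: countable_finite)
    qed
    moreover have "e \<in> extensional S" "f \<in> extensional S"
      using e f by (auto simp: idempotents_def product_ring_simps PiE_iff)
    ultimately show "e = f"
      using extensionalityI by blast
  qed
  then have "idempotents (product_ring S R) \<lesssim> Pow (S \<times> (UNIV :: nat set))"
    unfolding lepoll_def by (intro exI[of _ graph]) (auto simp: graph_def)
  also have "\<dots> \<lesssim> Pow S"
    using assms(1) infinite_le_lepoll
    by (intro Pow_lepoll_mono infinite_times_lepoll) auto
  finally show ?thesis .
qed

end

section \<open>Counting wild max-regular ideals\<close>

lemma (in cring_family) Pow_Pow_lepoll_wild_max_regular_ideals:
  assumes "infinite S" and nontrivial: "\<And>k. k \<in> S \<Longrightarrow> carrier (R k) \<noteq> {\<zero>\<^bsub>R k\<^esub>}"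
  shows "Pow (Pow S) \<lesssim> wild_max_regular_ideals S R"
proof -
  let ?P = "product_ring S R"
  obtain A :: "'i set \<Rightarrow> 'i set" where A:
    "\<And>P Q. \<lbrakk>finite P; finite Q; P \<subseteq> Pow S; Q \<subseteq> Pow S; P \<inter> Q = {}\<rbrakk> \<Longrightarrow>
      infinite {s \<in> S. (\<forall>T\<in>P. s \<in> A T) \<and> (\<forall>T\<in>Q. s \<notin> A T)}"
    using independent_family[OF assms(1)] by blast
  \<comment> \<open>A point outside all these sets has to avoid \<open>A T\<close> for
    \<open>T\<close> in \<open>C\<close> and lie in \<open>A T\<close> for the other
    \<open>T\<close>. Hence below the indices from \<open>C\<close> form the negative set
    \<open>Q\<close>, and those outside \<open>C\<close> the positive set \<open>P\<close>.\<close>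
  define \<F> where "\<F> C = A ` C \<union> (\<lambda>T. S - A T) ` (Pow S - C) \<union> (\<lambda>k. {k}) ` S" for C
  have no_cover: "\<not> S \<subseteq> \<Union>F" if C: "C \<subseteq> Pow S" and F: "finite F" "F \<subseteq> \<F> C" for C F
  proof -
    have "F = (F \<inter> A ` C) \<union> (F \<inter> (\<lambda>T. S - A T) ` (Pow S - C)) \<union> (F \<inter> (\<lambda>k. {k}) ` S)"
      using F(2) unfolding \<F>_def by blast
    moreover obtain Q where Q: "finite Q" "Q \<subseteq> C" "F \<inter> A ` C = A ` Q"
      using finite_subset_image[of "F \<inter> A ` C" A C] F(1) by auto
    moreover obtain P where P: "finite P" "P \<subseteq> Pow S - C"
      "F \<inter> (\<lambda>T. S - A T) ` (Pow S - C) = (\<lambda>T. S - A T) ` P"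
      using finite_subset_image[of "F \<inter> (\<lambda>T. S - A T) ` (Pow S - C)" "\<lambda>T. S - A T" "Pow S - C"] F(1)
      by auto
    moreover obtain K where K: "finite K" "F \<inter> (\<lambda>k. {k}) ` S = (\<lambda>k. {k}) ` K"
      using finite_subset_image[of "F \<inter> (\<lambda>k. {k}) ` S" "\<lambda>k. {k}" S] F(1) by auto
    ultimately have FQPK: "F = A ` Q \<union> (\<lambda>T. S - A T) ` P \<union> (\<lambda>k. {k}) ` K"
      by simp
    have "infinite {s \<in> S. (\<forall>T\<in>P. s \<in> A T) \<and> (\<forall>T\<in>Q. s \<notin> A T)}"
      using P Q C by (intro A) auto
    \<comment> \<open>Finitely many singletons cover only the finite set \<open>K\<close>; since
      independence supplies infinitely many points, one is left over.\<close>
    with K(1) have "infinite ({s \<in> S. (\<forall>T\<in>P. s \<in> A T) \<and> (\<forall>T\<in>Q. s \<notin> A T)} - K)"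
      by (rule Diff_infinite_finite)
    then have "{s \<in> S. (\<forall>T\<in>P. s \<in> A T) \<and> (\<forall>T\<in>Q. s \<notin> A T)} - K \<noteq> {}"
      by (rule infinite_imp_nonempty)
    then obtain s where "s \<in> S" "\<forall>T\<in>P. s \<in> A T" "\<forall>T\<in>Q. s \<notin> A T" "s \<notin> K"
      by blast
    then have "s \<in> S" "s \<notin> \<Union>F"
      by (auto simp: FQPK)
    then show ?thesis
      by blast
  qed
  have "\<exists>M. max_regular_ideal ?P M \<and> indicator_elt S R ` \<F> C \<subseteq> M" if C: "C \<subseteq> Pow S" for C
  proof -
    let ?E = "indicator_elt S R ` \<F> C"
    have E: "?E \<subseteq> idempotents ?P"
      using indicator_elt_idempotent by blast
    then have "regular_ideal ?P (Idl\<^bsub>?P\<^esub> ?E)"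
      unfolding regular_ideal_def by blast
    moreover have "Idl\<^bsub>?P\<^esub> ?E \<noteq> carrier ?P"
      using nontrivial no_cover[OF C] by (rule genideal_indicator_elt_proper)
    ultimately obtain M where "max_regular_ideal ?P M" "Idl\<^bsub>?P\<^esub> ?E \<subseteq> M"
      using prod.regular_ideal_le_max_regular by blast
    moreover have "?E \<subseteq> Idl\<^bsub>?P\<^esub> ?E"
      using E by (intro prod.genideal_self) (auto simp: idempotents_def)
    ultimately show ?thesis
      by blast
  qed
  then obtain M where M: "\<And>C. C \<subseteq> Pow S \<Longrightarrow> max_regular_ideal ?P (M C)"
    and EM: "\<And>C. C \<subseteq> Pow S \<Longrightarrow> indicator_elt S R ` \<F> C \<subseteq> M C"
    by metis
  \<comment> \<open>One inclusion suffices, as \<open>C\<close> and \<open>D\<close> can be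
    exchanged. An index in \<open>C\<close> but not in \<open>D\<close> would put two complementary
    indicators, with sum 1, into the common ideal.\<close>
  have sub: "C \<subseteq> D" if C: "C \<subseteq> Pow S" and D: "D \<subseteq> Pow S" and eq: "M C = M D" for C D
  proof (rule ccontr)
    interpret ideal "M C" ?P
      using M[OF C] prod.regular_ideal_iff by (auto simp: max_regular_ideal_def)
    assume "\<not> C \<subseteq> D"
    then obtain T where T: "T \<in> C" "T \<notin> D"
      by blast
    have "A T \<in> \<F> C" "S - A T \<in> \<F> D"
      using T C by (auto simp: \<F>_def)
    then have "indicator_elt S R (A T) \<in> M C" "indicator_elt S R (S - A T) \<in> M C"
      using EM[OF C] EM[OF D] eq by auto
    then have "indicator_elt S R (A T) \<oplus>\<^bsub>?P\<^esub> indicator_elt S R (S - A T) \<in> M C"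
      by (rule a_closed)
    then have "\<one>\<^bsub>?P\<^esub> \<in> M C"
      by (simp add: indicator_elt_compl)
    then show False
      using one_imp_carrier M[OF C] by (simp add: max_regular_ideal_def)
  qed
  have "inj_on M (Pow (Pow S))"
    by (rule inj_onI) (metis PowD sub subset_antisym)
  moreover have "M C \<in> wild_max_regular_ideals S R" if C: "C \<subseteq> Pow S" for C
  proof -
    have "indicator_elt S R {k} \<in> M C" if "k \<in> S" for k
      using EM[OF C] that by (auto simp: \<F>_def)
    then show ?thesis
      using M[OF C] zero_locus_wild by (simp add: wild_max_regular_ideals_def)
  qed
  ultimately show ?thesis
    unfolding lepoll_def by blast
qed

theorem corollary3p9:
  fixes S :: "'i set" and R :: "'i \<Rightarrow> ('a, 'm) ring_scheme"
  assumes "infinite S"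
    and "\<And>k. k \<in> S \<Longrightarrow> cring (R k)"
    and "\<And>k. k \<in> S \<Longrightarrow> carrier (R k) \<noteq> {\<zero>\<^bsub>R k\<^esub>}"
    and "\<And>k. k \<in> S \<Longrightarrow> finite (idempotents (R k))"
  shows "wild_max_regular_ideals S R \<approx> Pow (Pow S)"
proof (rule lepoll_antisym)
  interpret cring_family S R
    using assms(2) by (rule cring_family.intro)
  have "wild_max_regular_ideals S R \<lesssim> {I. regular_ideal (product_ring S R) I}"
    by (rule subset_imp_lepoll) (auto simp: wild_max_regular_ideals_def max_regular_ideal_def)
  also have "\<dots> \<lesssim> Pow (idempotents (product_ring S R))"
    by (rule prod.regular_ideals_lepoll)
  also have "\<dots> \<lesssim> Pow (Pow S)"
    using assms(1,4) by (intro Pow_lepoll_mono idempotents_product_lepoll)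
  finally show "wild_max_regular_ideals S R \<lesssim> Pow (Pow S)" .
  show "Pow (Pow S) \<lesssim> wild_max_regular_ideals S R"
    using assms(1,3) by (rule Pow_Pow_lepoll_wild_max_regular_ideals)
qed

end
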